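(* Let $f:\mathbb{R}^n\to\mathbb{R}$ be twice continuously differentiable and suppose there exists $L>0$ such that $\|\nabla^2 f(x)-\nabla^2 f(y)\|\le L\|x-y\|$ for all $x,y\in\mathbb{R}^n$. Let the ARC$_q$ algorithm described in the context be run with directions $d_k$ satisfying the approximate conditions (A) of the context at every iteration, with sampling parameter $\beta\ge1$. Suppose that there is a value $f_{\rm low}$ with $f(x_k)\ge f_{\rm low}$ for all $k$; that there is $\alpha_{\max}>0$ with $\alpha_k\le\alpha_{\max}$ for all $k$; that there are $\xi>0$ and $0<\zeta\le1$ with $\|r_k\|\le\xi\,\min(\|\nabla f(x_k)\|,\|d_k\|)^{1+\zeta}$ for all $k$; that $\{x_k\}\to x^*$ with $\nabla f(x^* )=0$ and $\nabla^2f(x^* )\succ0$; and that $r_k^Td_k=0$ for all sufficiently large $k$. Then there exists an iteration $K$ such that for all $k\ge K$, $$\|\nabla f(x_{k+1})\|=O\left(\|\nabla f(x_k)\|^{1+\zeta}\right),$$ i.e., there exist $K\in\mathbb{N}$ and a constant $M>0$ such that $\|\nabla f(x_{k+1})\|\le M\|\nabla f(x_k)\|^{1+\zeta}$ for all $k\ge K$.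
   Context: $\|\cdot\|$ is the Euclidean norm (and the induced matrix norm); $A\succ0$ means that the symmetric matrix $A$ is positive definite. For a current iterate $x_k$, the quadratic model is $q_k(d)=f(x_k)+\nabla f(x_k)^Td+\tfrac12 d^T\nabla^2 f(x_k)d$. ARC$_q$ algorithm: given $x_0\in\mathbb{R}^n$, $\alpha_0>0$, $0<\eta_1<\eta_2<1$, $0<\gamma_1<1<\gamma_2$, for $k=0,1,2,\dots$: compute a direction $d_k$ (see (A)); compute $\rho_k=\dfrac{f(x_k)-f(x_k+d_k)}{q_k(0)-q_k(d_k)}$; if $\rho_k<\eta_1$ (unsuccessful iteration), set $x_{k+1}=x_k$ and $\alpha_{k+1}=\gamma_1\alpha_k$; otherwise (successful iteration) set $x_{k+1}=x_k+d_k$, and set $\alpha_{k+1}=\gamma_2\alpha_k$ if $\rho_k>\eta_2$ (very successful), $\alpha_{k+1}=\alpha_k$ otherwise. Conditions (A): there are a shift $\lambda_k$ and a residual $r_k\in\mathbb{R}^n$ such that $\nabla f(x_k)+(\nabla^2 f(x_k)+\lambda_k I)d_k=r_k$, $\quad d_k^T(\nabla^2 f(x_k)+\lambda_k I)d_k\ge 0$, $\quad \dfrac1\beta\dfrac{\|d_k\|}{\alpha_k}\le\lambda_k\le\beta\dfrac{\|d_k\|}{\alpha_k}$, where $\beta\ge1$ is a fixed sampling parameter. *)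

theory Defs
  imports "HOL-Analysis.Analysis"
begin

text \<open>
  The gradient and the Hessian are passed around as functions g and H. They are determined by f
  through the following predicate, which says that f is twice continuously differentiable with
  gradient g and Hessian matrix H.
\<close>

definition C2_with_gradient_hessian ::
  "(real ^ 'n \<Rightarrow> real) \<Rightarrow> (real ^ 'n \<Rightarrow> real ^ 'n) \<Rightarrow> (real ^ 'n \<Rightarrow> real ^ 'n ^ 'n) \<Rightarrow> bool"
  where
  "C2_with_gradient_hessian f g H \<longleftrightarrow>
     (\<forall>x. GDERIV f x :> g x) \<and>
     (\<forall>x. (g has_derivative (\<lambda>h. H x *v h)) (at x)) \<and>
     continuous_on UNIV H"

text \<open>The matrix norm induced by the Euclidean norm (norm itself is the Frobenius norm on this type).\<close>

definition induced_norm :: "real ^ 'n ^ 'n \<Rightarrow> real" where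
  "induced_norm A = onorm (\<lambda>v. A *v v)"

definition positive_definite :: "real ^ 'n ^ 'n \<Rightarrow> bool" where
  "positive_definite A \<longleftrightarrow> transpose A = A \<and> (\<forall>v. v \<noteq> 0 \<longrightarrow> v \<bullet> (A *v v) > 0)"

definition quadratic_model ::
  "(real ^ 'n \<Rightarrow> real) \<Rightarrow> (real ^ 'n \<Rightarrow> real ^ 'n) \<Rightarrow> (real ^ 'n \<Rightarrow> real ^ 'n ^ 'n)
    \<Rightarrow> real ^ 'n \<Rightarrow> real ^ 'n \<Rightarrow> real"
  where
  "quadratic_model f g H x d = f x + g x \<bullet> d + 1 / 2 * (d \<bullet> (H x *v d))"

text \<open>
  If the predicted decrease is 0 (as for a zero step at a stationary point), the quotient has the
  value 0 by the HOL convention for division, so the iteration counts as unsuccessful.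
\<close>

definition decrease_ratio ::
  "(real ^ 'n \<Rightarrow> real) \<Rightarrow> (real ^ 'n \<Rightarrow> real ^ 'n) \<Rightarrow> (real ^ 'n \<Rightarrow> real ^ 'n ^ 'n)
    \<Rightarrow> real ^ 'n \<Rightarrow> real ^ 'n \<Rightarrow> real"
  where
  "decrease_ratio f g H x d =
     (f x - f (x + d)) / (quadratic_model f g H x 0 - quadratic_model f g H x d)"

text \<open>The sequences x, \<alpha> and d are the iterates, parameters and directions of a run of ARCq.\<close>

definition ARCq_run ::
  "(real ^ 'n \<Rightarrow> real) \<Rightarrow> (real ^ 'n \<Rightarrow> real ^ 'n) \<Rightarrow> (real ^ 'n \<Rightarrow> real ^ 'n ^ 'n)
    \<Rightarrow> real \<Rightarrow> real \<Rightarrow> real \<Rightarrow> real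
    \<Rightarrow> (nat \<Rightarrow> real ^ 'n) \<Rightarrow> (nat \<Rightarrow> real) \<Rightarrow> (nat \<Rightarrow> real ^ 'n) \<Rightarrow> bool"
  where
  "ARCq_run f g H \<eta>1 \<eta>2 \<gamma>1 \<gamma>2 x \<alpha> d \<longleftrightarrow>
     \<alpha> 0 > 0 \<and> 0 < \<eta>1 \<and> \<eta>1 < \<eta>2 \<and> \<eta>2 < 1 \<and> 0 < \<gamma>1 \<and> \<gamma>1 < 1 \<and> 1 < \<gamma>2 \<and>
     (\<forall>k. let \<rho> = decrease_ratio f g H (x k) (d k) in
        if \<rho> < \<eta>1 then x (Suc k) = x k \<and> \<alpha> (Suc k) = \<gamma>1 * \<alpha> k
        else x (Suc k) = x k + d k \<and>
             \<alpha> (Suc k) = (if \<rho> > \<eta>2 then \<gamma>2 * \<alpha> k else \<alpha> k))"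

text \<open>
  The approximate conditions on a direction d with shift lam and residual r, at a point with
  gradient g and Hessian H; mat lam is lam times the identity matrix.
\<close>

definition approx_step_conditions ::
  "real \<Rightarrow> real ^ 'n \<Rightarrow> real ^ 'n ^ 'n \<Rightarrow> real \<Rightarrow> real ^ 'n \<Rightarrow> real \<Rightarrow> real ^ 'n \<Rightarrow> bool"
  where
  "approx_step_conditions \<beta> g H \<alpha> d lam r \<longleftrightarrow>
     g + (H + mat lam) *v d = r \<and>
     d \<bullet> ((H + mat lam) *v d) \<ge> 0 \<and>
     1 / \<beta> * (norm d / \<alpha>) \<le> lam \<and> lam \<le> \<beta> * (norm d / \<alpha>)"

end

theory Submission
  imports Defs
begin

text \<open>
  Close to the minimizer the method is an inexact Newton method whose perturbation is of second
  order. Let \<open>\<mu>\<close> be a lower bound for the eigenvalues of the Hessian near \<open>x_star\<close>. Pairing the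
  step equation with \<open>d\<close> and using \<open>r \<bullet> d = 0\<close> gives
  \<open>\<mu> \<parallel>d\<parallel>\<^sup>2 \<le> - (g \<bullet> d)\<close>, hence \<open>\<mu> \<parallel>d\<parallel> \<le> \<parallel>g\<parallel>\<close>
  (\<open>approx_step_norm_le_gradient\<close>), so the steps tend to 0.

  The same pairing shows that the model predicts a decrease of at least \<open>(\<mu> / 2) \<parallel>d\<parallel>\<^sup>2\<close>. As
  the Hessian is Lipschitz, model and function differ by \<open>O(\<parallel>d\<parallel>\<^sup>3)\<close>, so from some
  iteration \<open>K\<close> on every nonzero step is very successful (\<open>step_very_successful\<close>). A zero step
  leaves a zero residual and so occurs only where the gradient vanishes, and from such a point the
  iterates never move again. Up to that event, if it happens at all, the parameter \<open>\<alpha>\<close> does not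
  fall below its value at \<open>K\<close>, whence the shift is \<open>O(\<parallel>d\<parallel>)\<close>.

  Finally the step equation says that the linearized gradient at \<open>x + d\<close> is \<open>r - lam d\<close>, so the true
  gradient there is \<open>\<parallel>r\<parallel> + O(\<parallel>d\<parallel>\<^sup>2)\<close> in norm (\<open>gradient_after_step\<close>). The residual is
  \<open>O(\<parallel>g\<parallel>\<^bsup>1+\<zeta>\<^esup>)\<close> by hypothesis, and \<open>\<parallel>d\<parallel>\<^sup>2 = O(\<parallel>g\<parallel>\<^sup>2)\<close> is at least as small because
  \<open>\<zeta> \<le> 1\<close> and \<open>\<parallel>g\<parallel> \<le> 1\<close> eventually.
\<close>

section \<open>Taylor estimates for a Lipschitz Hessian\<close>

lemma norm_matrix_vector_le_induced_norm:
  fixes A :: "real ^ 'n ^ 'n"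
  shows "norm (A *v v) \<le> induced_norm A * norm v"
  unfolding induced_norm_def
  by (rule onorm) (simp add: matrix_vector_mul_bounded_linear)

text \<open>
  The mean value inequality for \<open>y \<mapsto> g y - H x y\<close>, whose derivative \<open>H y - H x\<close> has norm at most
  \<open>L \<parallel>d\<parallel>\<close> on the segment. Integrating instead would give the constant \<open>L / 2\<close>; only the order in
  \<open>\<parallel>d\<parallel>\<close> matters below.
\<close>

lemma gradient_linearization_error:
  fixes g :: "real ^ 'n \<Rightarrow> real ^ 'n" and H :: "real ^ 'n \<Rightarrow> real ^ 'n ^ 'n"
  assumes deriv: "\<And>x. (g has_derivative (\<lambda>h. H x *v h)) (at x)"
    and lip: "\<And>y z. induced_norm (H y - H z) \<le> L * norm (y - z)"
    and "L \<ge> 0"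
  shows "norm (g (x + d) - g x - H x *v d) \<le> L * (norm d)\<^sup>2"
proof -
  let ?\<psi> = "\<lambda>y. g y - H x *v y"
  have d\<psi>: "(?\<psi> has_derivative (\<lambda>h. (H y - H x) *v h)) (at y within closed_segment x (x + d))" for y
    unfolding matrix_vector_mult_diff_rdistrib
    by (intro has_derivative_diff has_derivative_at_withinI[OF deriv]
        bounded_linear_imp_has_derivative matrix_vector_mul_bounded_linear)
  have bound: "onorm (\<lambda>h. (H y - H x) *v h) \<le> L * norm d" if "y \<in> closed_segment x (x + d)" for y
  proof -
    have "norm (y - x) \<le> norm d"
      using segment_bound1[OF that] by simp
    then have "L * norm (y - x) \<le> L * norm d"
      using \<open>L \<ge> 0\<close> by (rule mult_left_mono)
    then show ?thesis
      using lip[of y x] unfolding induced_norm_def by linarith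
  qed
  have "norm (?\<psi> (x + d) - ?\<psi> x) \<le> L * norm d * norm ((x + d) - x)"
    by (rule differentiable_bound[OF convex_closed_segment d\<psi> bound]) auto
  then show ?thesis
    by (simp add: matrix_vector_right_distrib power2_eq_square algebra_simps)
qed

text \<open>
  Along the segment, the derivative of the difference between \<open>f\<close> and its model is the
  linearization error of the gradient paired with \<open>d\<close>, so the mean value theorem reduces this
  bound to the previous one.
\<close>

lemma quadratic_model_error:
  fixes f :: "real ^ 'n \<Rightarrow> real"
  assumes C2: "C2_with_gradient_hessian f g H"
    and lip: "\<And>y z. induced_norm (H y - H z) \<le> L * norm (y - z)"
    and "L \<ge> 0"
  shows "\<bar>f (x + d) - quadratic_model f g H x d\<bar> \<le> L * norm d ^ 3"
proof -
  have df: "(f has_derivative (\<lambda>h. h \<bullet> g y)) (at y)" for y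
    using C2 unfolding C2_with_gradient_hessian_def gderiv_def by blast
  have dg: "(g has_derivative (\<lambda>h. H y *v h)) (at y)" for y
    using C2 unfolding C2_with_gradient_hessian_def by blast
  let ?\<phi> = "\<lambda>t. f (x + t *\<^sub>R d) - t * (g x \<bullet> d) - t\<^sup>2 / 2 * (d \<bullet> (H x *v d))"
  let ?\<phi>' = "\<lambda>t. (g (x + t *\<^sub>R d) - g x - t *\<^sub>R (H x *v d)) \<bullet> d"
  have "(?\<phi> has_real_derivative ?\<phi>' t) (at t)" for t
  proof -
    have "((\<lambda>t. x + t *\<^sub>R d) has_derivative (\<lambda>h. h *\<^sub>R d)) (at t)"
      by (auto intro!: derivative_eq_intros)
    from has_derivative_compose[OF this df]
    have "((\<lambda>t. f (x + t *\<^sub>R d)) has_real_derivative d \<bullet> g (x + t *\<^sub>R d)) (at t)"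
      unfolding has_field_derivative_def
      by (simp add: mult.commute[of _ "d \<bullet> g (x + t *\<^sub>R d)"])
    then show ?thesis
      by (auto intro!: derivative_eq_intros simp: inner_diff_left inner_commute algebra_simps)
  qed
  then obtain t where t: "0 < t" "t < 1" "?\<phi> 1 - ?\<phi> 0 = ?\<phi>' t"
    using MVT2[of 0 1 ?\<phi> ?\<phi>'] by auto
  have "\<bar>?\<phi>' t\<bar> \<le> norm (g (x + t *\<^sub>R d) - g x - t *\<^sub>R (H x *v d)) * norm d"
    by (rule Cauchy_Schwarz_ineq2)
  also have "\<dots> \<le> (L * (norm (t *\<^sub>R d))\<^sup>2) * norm d"
    using gradient_linearization_error[OF dg lip \<open>L \<ge> 0\<close>, of x "t *\<^sub>R d"]
    by (intro mult_right_mono) (simp_all add: matrix_vector_mult_scaleR)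
  also have "\<dots> \<le> (L * (norm d)\<^sup>2) * norm d"
    using t \<open>L \<ge> 0\<close>
    by (intro mult_right_mono mult_left_mono power_mono) (auto simp: mult_left_le_one_le)
  also have "\<dots> = L * norm d ^ 3"
    by (simp add: power2_eq_square power3_eq_cube)
  finally show ?thesis
    using t(3) by (simp add: quadratic_model_def algebra_simps)
qed

section \<open>Uniform convexity near a minimizer\<close>

text \<open>
  By compactness the quadratic form attains a positive minimum on the unit sphere; homogeneity
  carries this bound to all vectors.
\<close>

lemma positive_definite_coercive:
  fixes A :: "real ^ 'n ^ 'n"
  assumes "positive_definite A"
  obtains \<mu> where "\<mu> > 0" "\<And>v. v \<bullet> (A *v v) \<ge> \<mu> * (norm v)\<^sup>2"
proof -
  let ?S = "sphere (0 :: real ^ 'n) 1"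
  have cont: "continuous_on ?S (\<lambda>v. v \<bullet> (A *v v))"
    by (intro continuous_intros linear_continuous_on matrix_vector_mul_bounded_linear)
  have "?S \<noteq> {}" by simp
  then obtain u where u: "u \<in> ?S" "\<And>v. v \<in> ?S \<Longrightarrow> u \<bullet> (A *v u) \<le> v \<bullet> (A *v v)"
    using continuous_attains_inf[OF compact_sphere _ cont] by blast
  show ?thesis
  proof
    have "u \<noteq> 0" using u(1) by auto
    then show "u \<bullet> (A *v u) > 0"
      using assms by (simp add: positive_definite_def)
    show "v \<bullet> (A *v v) \<ge> u \<bullet> (A *v u) * (norm v)\<^sup>2" for v
    proof (cases "v = 0")
      case False
      let ?w = "(1 / norm v) *\<^sub>R v"
      have "?w \<in> ?S" using False by simp
      then have "u \<bullet> (A *v u) \<le> ?w \<bullet> (A *v ?w)" by (rule u(2))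
      also have "\<dots> = (v \<bullet> (A *v v)) / (norm v)\<^sup>2"
        by (simp add: matrix_vector_mult_scaleR power2_eq_square)
      finally show ?thesis using False by (simp add: field_simps)
    qed simp
  qed
qed

lemma quadratic_form_lower_bound_perturbed:
  fixes A B :: "real ^ 'n ^ 'n"
  assumes "v \<bullet> (A *v v) \<ge> \<mu> * (norm v)\<^sup>2" and "induced_norm (B - A) \<le> \<epsilon>"
  shows "v \<bullet> (B *v v) \<ge> (\<mu> - \<epsilon>) * (norm v)\<^sup>2"
proof -
  have "\<bar>v \<bullet> ((B - A) *v v)\<bar> \<le> norm v * norm ((B - A) *v v)"
    by (rule Cauchy_Schwarz_ineq2)
  also have "\<dots> \<le> norm v * (\<epsilon> * norm v)"
    by (intro mult_left_mono order_trans[OF norm_matrix_vector_le_induced_norm]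
        mult_right_mono assms(2)) auto
  finally have "\<bar>v \<bullet> (B *v v) - v \<bullet> (A *v v)\<bar> \<le> \<epsilon> * (norm v)\<^sup>2"
    by (simp add: matrix_vector_mult_diff_rdistrib inner_diff_right power2_eq_square algebra_simps)
  then show ?thesis using assms(1) by (simp add: algebra_simps)
qed

section \<open>A single step where the Hessian is coercive\<close>

lemma approx_step_equation:
  fixes H :: "real ^ 'n ^ 'n"
  assumes "approx_step_conditions \<beta> g H \<alpha> d lam r"
  shows "g + H *v d + lam *\<^sub>R d = r"
proof -
  have "mat lam *v d = lam *\<^sub>R d"
    by (simp add: vec_eq_iff matrix_vector_mult_def mat_def if_distrib if_distribR
        sum.delta cong: if_cong)
  then show ?thesis
    using assms by (simp add: approx_step_conditions_def matrix_vector_mult_add_rdistrib add.assoc)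
qed

lemma approx_step_shift_nonneg:
  assumes "approx_step_conditions \<beta> g H \<alpha> d lam r" and "\<alpha> > 0" and "\<beta> \<ge> 1"
  shows "lam \<ge> 0"
proof -
  have "0 \<le> 1 / \<beta> * (norm d / \<alpha>)" using assms(2,3) by simp
  then show ?thesis using assms(1) by (auto simp: approx_step_conditions_def)
qed

text \<open>
  Orthogonality of the residual makes an inexact step satisfy the same energy identity as an
  exact one. The bound on the step length and the predicted decrease both rest on it.
\<close>

lemma approx_step_directional_derivative:
  assumes "approx_step_conditions \<beta> g H \<alpha> d lam r" and "r \<bullet> d = 0"
  shows "- (g \<bullet> d) = d \<bullet> (H *v d) + lam * (norm d)\<^sup>2"
proof -
  have "(g + H *v d + lam *\<^sub>R d) \<bullet> d = 0"
    using approx_step_equation[OF assms(1)] assms(2) by simp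
  then show ?thesis
    by (simp add: inner_add_left inner_commute[of d "H *v d"] power2_norm_eq_inner)
qed

lemma approx_step_norm_le_gradient:
  assumes step: "approx_step_conditions \<beta> g H \<alpha> d lam r" and "\<alpha> > 0" and "\<beta> \<ge> 1"
    and orth: "r \<bullet> d = 0" and coercive: "d \<bullet> (H *v d) \<ge> \<mu> * (norm d)\<^sup>2"
  shows "\<mu> * norm d \<le> norm g"
proof (cases "d = 0")
  case False
  have "\<mu> * (norm d)\<^sup>2 \<le> - (g \<bullet> d)"
    unfolding approx_step_directional_derivative[OF step orth]
    using coercive approx_step_shift_nonneg[OF assms(1-3)] by (simp add: add_increasing2)
  also have "\<dots> \<le> norm g * norm d"
    using Cauchy_Schwarz_ineq2[of g d] by linarith
  finally show ?thesis using False by (simp add: power2_eq_square)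
qed simp

text \<open>
  The predicted decrease is at least \<open>(\<mu> / 2) \<parallel>d\<parallel>\<^sup>2\<close> and the actual one differs from it by at most
  \<open>L \<parallel>d\<parallel>\<^sup>3\<close>, so their ratio tends to 1 with \<open>\<parallel>d\<parallel>\<close>. The hypothesis on \<open>L \<parallel>d\<parallel>\<close> keeps the
  relative error below \<open>1 - \<eta>\<close>.
\<close>

lemma step_very_successful:
  fixes f :: "real ^ 'n \<Rightarrow> real"
  assumes C2: "C2_with_gradient_hessian f g H"
    and lip: "\<And>y z. induced_norm (H y - H z) \<le> L * norm (y - z)" and "L \<ge> 0"
    and step: "approx_step_conditions \<beta> (g x) (H x) \<alpha> d lam r" and "\<alpha> > 0" and "\<beta> \<ge> 1"
    and orth: "r \<bullet> d = 0" and coercive: "d \<bullet> (H x *v d) \<ge> \<mu> * (norm d)\<^sup>2"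
    and "\<mu> > 0" and "d \<noteq> 0"
    and small: "L * norm d < (1 - \<eta>) * (\<mu> / 2)" and "\<eta> < 1"
  shows "decrease_ratio f g H x d > \<eta>"
proof -
  let ?m = "quadratic_model f g H x 0 - quadratic_model f g H x d"
  have "?m = d \<bullet> (H x *v d) / 2 + lam * (norm d)\<^sup>2"
    using approx_step_directional_derivative[OF step orth] by (simp add: quadratic_model_def)
  then have m: "?m \<ge> \<mu> / 2 * (norm d)\<^sup>2"
    using coercive approx_step_shift_nonneg[OF step \<open>\<alpha> > 0\<close> \<open>\<beta> \<ge> 1\<close>] by (simp add: add_increasing2)
  have "\<mu> / 2 * (norm d)\<^sup>2 > 0"
    using \<open>\<mu> > 0\<close> \<open>d \<noteq> 0\<close> by simp
  then have m_pos: "?m > 0" using m by linarith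
  have "L * norm d ^ 3 = (L * norm d) * (norm d)\<^sup>2"
    by (simp add: power2_eq_square power3_eq_cube)
  also have "\<dots> < (1 - \<eta>) * (\<mu> / 2) * (norm d)\<^sup>2"
    using small \<open>d \<noteq> 0\<close> by (intro mult_strict_right_mono) auto
  also have "\<dots> \<le> (1 - \<eta>) * ?m"
    using m \<open>\<eta> < 1\<close> unfolding mult.assoc by (intro mult_left_mono) auto
  finally have "L * norm d ^ 3 < (1 - \<eta>) * ?m" .
  moreover have "f x - f (x + d) \<ge> ?m - L * norm d ^ 3"
    using quadratic_model_error[OF C2 lip \<open>L \<ge> 0\<close>, of x d]
    by (simp add: quadratic_model_def abs_le_iff)
  ultimately have "f x - f (x + d) > \<eta> * ?m"
    by (simp add: algebra_simps)
  then show ?thesis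
    using m_pos by (simp add: decrease_ratio_def pos_less_divide_eq)
qed

text \<open>
  The step equation reads \<open>g x + H x d = r - lam d\<close>: the shift is what separates the step from a
  Newton step with residual \<open>r\<close>. A lower bound \<open>a\<close> on the parameter makes the shift
  \<open>O(\<parallel>d\<parallel>)\<close>, so its contribution is quadratic, like the linearization error.
\<close>

lemma gradient_after_step:
  fixes g :: "real ^ 'n \<Rightarrow> real ^ 'n" and H :: "real ^ 'n \<Rightarrow> real ^ 'n ^ 'n"
  assumes deriv: "\<And>x. (g has_derivative (\<lambda>h. H x *v h)) (at x)"
    and lip: "\<And>y z. induced_norm (H y - H z) \<le> L * norm (y - z)" and "L \<ge> 0"
    and step: "approx_step_conditions \<beta> (g x) (H x) \<alpha> d lam r" and "\<beta> \<ge> 1"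
    and "a > 0" and "a \<le> \<alpha>"
  shows "norm (g (x + d)) \<le> norm r + (L + \<beta> / a) * (norm d)\<^sup>2"
proof -
  have "\<alpha> > 0" using \<open>a > 0\<close> \<open>a \<le> \<alpha>\<close> by simp
  have "norm d / \<alpha> \<le> norm d / a"
    using \<open>a > 0\<close> \<open>a \<le> \<alpha>\<close> by (intro divide_left_mono) auto
  then have "\<beta> * (norm d / \<alpha>) \<le> \<beta> * (norm d / a)"
    using \<open>\<beta> \<ge> 1\<close> by (intro mult_left_mono) auto
  then have lam_le: "lam \<le> \<beta> / a * norm d"
    using step by (auto simp: approx_step_conditions_def)
  have "g x = r - lam *\<^sub>R d - H x *v d"
    using approx_step_equation[OF step] by (simp add: algebra_simps)
  then have "g (x + d) = r - lam *\<^sub>R d + (g (x + d) - g x - H x *v d)"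
    by simp
  also have "norm \<dots> \<le> norm r + norm (lam *\<^sub>R d) + norm (g (x + d) - g x - H x *v d)"
    by (meson add_right_mono norm_triangle_ineq norm_triangle_ineq4 order_trans)
  also have "norm (lam *\<^sub>R d) \<le> \<beta> / a * norm d * norm d"
    using lam_le approx_step_shift_nonneg[OF step \<open>\<alpha> > 0\<close> \<open>\<beta> \<ge> 1\<close>]
    unfolding norm_scaleR by (intro mult_right_mono) auto
  also have "norm (g (x + d) - g x - H x *v d) \<le> L * (norm d)\<^sup>2"
    by (rule gradient_linearization_error[OF deriv lip \<open>L \<ge> 0\<close>])
  finally show ?thesis
    by (simp add: power2_eq_square algebra_simps)
qed

lemma approx_step_zero_imp_stationary:
  assumes "approx_step_conditions \<beta> g H \<alpha> 0 lam r"
    and "norm r \<le> \<xi> * min (norm g) 0 powr p"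
  shows "g = 0"
  using approx_step_equation[OF assms(1)] assms(2) by (simp add: min_absorb2)

section \<open>Runs of the algorithm\<close>

lemma ARCq_run_parameter_pos:
  assumes run: "ARCq_run f g H \<eta>1 \<eta>2 \<gamma>1 \<gamma>2 x \<alpha> d"
  shows "\<alpha> k > 0"
proof (induction k)
  case 0
  then show ?case using run by (simp add: ARCq_run_def)
next
  case (Suc k)
  have "\<alpha> (Suc k) \<in> {\<gamma>1 * \<alpha> k, \<gamma>2 * \<alpha> k, \<alpha> k}"
    using run by (auto simp: ARCq_run_def Let_def split: if_splits)
  moreover have "\<gamma>1 > 0" "\<gamma>2 > 0" using run by (auto simp: ARCq_run_def)
  ultimately show ?case using Suc by auto
qed

text \<open>An accepted zero step does not move the iterate either.\<close>

lemma ARCq_run_zero_step: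
  assumes "ARCq_run f g H \<eta>1 \<eta>2 \<gamma>1 \<gamma>2 x \<alpha> d" and "d k = 0"
  shows "x (Suc k) = x k"
  using assms by (auto simp: ARCq_run_def Let_def) (metis add.right_neutral)

lemma ARCq_run_very_successful:
  assumes run: "ARCq_run f g H \<eta>1 \<eta>2 \<gamma>1 \<gamma>2 x \<alpha> d"
    and \<rho>: "decrease_ratio f g H (x k) (d k) > \<eta>2"
  shows "x (Suc k) = x k + d k" and "\<alpha> k \<le> \<alpha> (Suc k)"
proof -
  have "\<not> decrease_ratio f g H (x k) (d k) < \<eta>1"
    using run \<rho> by (auto simp: ARCq_run_def)
  then have "x (Suc k) = x k + d k \<and> \<alpha> (Suc k) = \<gamma>2 * \<alpha> k"
    using run \<rho> by (auto simp: ARCq_run_def Let_def)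
  moreover have "\<alpha> k \<le> \<gamma>2 * \<alpha> k"
    using run ARCq_run_parameter_pos[OF run, of k] by (simp add: ARCq_run_def)
  ultimately show "x (Suc k) = x k + d k" and "\<alpha> k \<le> \<alpha> (Suc k)"
    by auto
qed

theorem theorem2p5:
  fixes f :: "real ^ 'n \<Rightarrow> real"
    and g :: "real ^ 'n \<Rightarrow> real ^ 'n"
    and H :: "real ^ 'n \<Rightarrow> real ^ 'n ^ 'n"
    and x d r :: "nat \<Rightarrow> real ^ 'n"
    and \<alpha> lam :: "nat \<Rightarrow> real"
    and x_star :: "real ^ 'n"
    and L \<eta>1 \<eta>2 \<gamma>1 \<gamma>2 \<beta> f_low \<alpha>_max \<xi> \<zeta> :: real
  assumes "C2_with_gradient_hessian f g H"
    and "L > 0"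
    and "\<And>y z. induced_norm (H y - H z) \<le> L * norm (y - z)"
    and "ARCq_run f g H \<eta>1 \<eta>2 \<gamma>1 \<gamma>2 x \<alpha> d"
    and "\<beta> \<ge> 1"
    and "\<And>k. approx_step_conditions \<beta> (g (x k)) (H (x k)) (\<alpha> k) (d k) (lam k) (r k)"
    and "\<And>k. f (x k) \<ge> f_low"
    and "\<alpha>_max > 0"
    and "\<And>k. \<alpha> k \<le> \<alpha>_max"
    and "\<xi> > 0" and "0 < \<zeta>" and "\<zeta> \<le> 1"
    and "\<And>k. norm (r k) \<le> \<xi> * (min (norm (g (x k))) (norm (d k))) powr (1 + \<zeta>)"
    and "x \<longlonglongrightarrow> x_star"
    and "g x_star = 0"
    and "positive_definite (H x_star)"
    and "\<forall>\<^sub>F k in sequentially. r k \<bullet> d k = 0"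
  shows "\<exists>K M. M > 0 \<and>
           (\<forall>k\<ge>K. norm (g (x (Suc k))) \<le> M * norm (g (x k)) powr (1 + \<zeta>))"
proof -
  note C2 = assms(1) and lip = assms(3) and run = assms(4) and step = assms(6)
    and residual = assms(13)
  have "L \<ge> 0" using \<open>L > 0\<close> by simp
  have "\<eta>2 < 1" using run by (simp add: ARCq_run_def)
  have deriv: "(g has_derivative (\<lambda>h. H y *v h)) (at y)" for y
    using C2 unfolding C2_with_gradient_hessian_def by blast
  have \<alpha>_pos: "\<alpha> k > 0" for k
    by (rule ARCq_run_parameter_pos[OF run])
  obtain m where "m > 0" and m: "\<And>v. v \<bullet> (H x_star *v v) \<ge> m * (norm v)\<^sup>2"
    using positive_definite_coercive[OF \<open>positive_definite (H x_star)\<close>] by blast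
  \<comment> \<open>Half of the curvature at the limit is kept as a margin for the nearby Hessians.\<close>
  define \<mu> where "\<mu> = m / 2"
  have "\<mu> > 0" using \<open>m > 0\<close> by (simp add: \<mu>_def)
  \<comment> \<open>The threshold on \<open>L * norm d\<close> below which a nonzero step is very successful.\<close>
  define \<delta> where "\<delta> = (1 - \<eta>2) * (\<mu> / 2)"
  have "\<delta> > 0" using \<open>\<eta>2 < 1\<close> \<open>\<mu> > 0\<close> by (simp add: \<delta>_def)

  have "(\<lambda>k. norm (x k - x_star)) \<longlonglongrightarrow> 0"
    using \<open>x \<longlonglongrightarrow> x_star\<close> by (simp add: LIM_zero_iff tendsto_norm_zero)
  then have "(\<lambda>k. L * norm (x k - x_star)) \<longlonglongrightarrow> 0"
    by (rule tendsto_mult_right_zero)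
  then have ev_near: "\<forall>\<^sub>F k in sequentially. L * norm (x k - x_star) < \<mu>"
    using \<open>\<mu> > 0\<close> by (rule order_tendstoD)
  have "isCont g x_star"
    by (rule has_derivative_continuous[OF deriv])
  then have "(\<lambda>k. g (x k)) \<longlonglongrightarrow> 0"
    using isCont_tendsto_compose[OF _ \<open>x \<longlonglongrightarrow> x_star\<close>] \<open>g x_star = 0\<close> by metis
  then have g_lim: "(\<lambda>k. norm (g (x k))) \<longlonglongrightarrow> 0"
    by (rule tendsto_norm_zero)
  have ev_small: "\<forall>\<^sub>F k in sequentially. norm (g (x k)) < min 1 (\<mu> * \<delta> / L)"
    using \<open>\<mu> > 0\<close> \<open>\<delta> > 0\<close> \<open>L > 0\<close> by (intro order_tendstoD[OF g_lim]) simp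
  from eventually_conj[OF ev_near eventually_conj[OF ev_small assms(17)]]
  obtain K where K: "\<And>k. k \<ge> K \<Longrightarrow> L * norm (x k - x_star) < \<mu>
      \<and> norm (g (x k)) < min 1 (\<mu> * \<delta> / L) \<and> r k \<bullet> d k = 0"
    unfolding eventually_sequentially by blast

  have coercive: "v \<bullet> (H (x k) *v v) \<ge> \<mu> * (norm v)\<^sup>2" if "k \<ge> K" for k v
  proof -
    have "induced_norm (H (x k) - H x_star) \<le> \<mu>"
      using lip[of "x k" x_star] K[OF that] by linarith
    from quadratic_form_lower_bound_perturbed[OF m this]
    show ?thesis by (simp add: \<mu>_def)
  qed
  have d_le: "\<mu> * norm (d k) \<le> norm (g (x k))" if "k \<ge> K" for k
    using K[OF that] coercive[OF that]
    by (intro approx_step_norm_le_gradient[OF step \<alpha>_pos \<open>\<beta> \<ge> 1\<close>]) auto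
  have very_successful: "decrease_ratio f g H (x k) (d k) > \<eta>2" if "k \<ge> K" "d k \<noteq> 0" for k
  proof -
    have "\<mu> * norm (d k) < \<mu> * \<delta> / L"
      using d_le[OF that(1)] K[OF that(1)] by simp
    then have "L * norm (d k) < \<delta>"
      using \<open>\<mu> > 0\<close> \<open>L > 0\<close> by (simp add: field_simps)
    then show ?thesis
      unfolding \<delta>_def using K[OF that(1)] that(2)
      by (intro step_very_successful[OF C2 lip \<open>L \<ge> 0\<close> step \<alpha>_pos \<open>\<beta> \<ge> 1\<close> _
            coercive[OF that(1)] \<open>\<mu> > 0\<close> _ _ \<open>\<eta>2 < 1\<close>]) auto
  qed
  have stationary: "g (x (Suc k)) = 0" if "d k = 0" for k
    using approx_step_zero_imp_stationary[of \<beta> "g (x k)" "H (x k)" "\<alpha> k" "lam k" "r k"]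
      step[of k] residual[of k] ARCq_run_zero_step[OF run that] that by auto
  \<comment> \<open>Zero steps are absorbing: the gradient is 0 from then on, and \<open>d_le\<close> forces the next step to be
    0 again. As long as no zero step has occurred, every iteration is very successful and enlarges
    the parameter.\<close>
  have dichotomy: "d k = 0 \<or> \<alpha> K \<le> \<alpha> k" if "k \<ge> K" for k
    using that
  proof (induction k rule: dec_induct)
    case (step k)
    show ?case
    proof (cases "d k = 0")
      case True
      then have "\<mu> * norm (d (Suc k)) \<le> 0"
        using d_le[of "Suc k"] stationary step.hyps by auto
      then show ?thesis using \<open>\<mu> > 0\<close> by (simp add: mult_le_0_iff)
    next
      case False
      then have "\<alpha> k \<le> \<alpha> (Suc k)"
        using ARCq_run_very_successful(2)[OF run] very_successful step.hyps by blast
      then show ?thesis using False step.IH by simp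
    qed
  qed simp

  define C where "C = L + \<beta> / \<alpha> K"
  have "C > 0"
    using \<open>L > 0\<close> \<open>\<beta> \<ge> 1\<close> \<alpha>_pos[of K] by (simp add: C_def add_pos_pos)
  define M where "M = \<xi> + C / \<mu>\<^sup>2"
  have "M > 0" using \<open>\<xi> > 0\<close> \<open>C > 0\<close> \<open>\<mu> > 0\<close> by (simp add: M_def add_pos_pos)
  have "norm (g (x (Suc k))) \<le> M * norm (g (x k)) powr (1 + \<zeta>)" if "k \<ge> K" for k
  proof (cases "d k = 0")
    case True
    then show ?thesis using stationary \<open>M > 0\<close> by simp
  next
    case False
    let ?G = "norm (g (x k))"
    have "norm (g (x (Suc k))) \<le> norm (r k) + C * (norm (d k))\<^sup>2"
      using gradient_after_step[OF deriv lip \<open>L \<ge> 0\<close> step \<open>\<beta> \<ge> 1\<close> \<alpha>_pos[of K]]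
        dichotomy[OF that] False
        ARCq_run_very_successful(1)[OF run very_successful[OF that False]]
      by (simp add: C_def)
    also have "norm (r k) \<le> \<xi> * ?G powr (1 + \<zeta>)"
      using \<open>\<xi> > 0\<close> \<open>0 < \<zeta>\<close>
      by (intro order_trans[OF residual] mult_left_mono powr_mono2) auto
    also have "C * (norm (d k))\<^sup>2 \<le> C * (?G powr (1 + \<zeta>) / \<mu>\<^sup>2)"
    proof -
      have "(\<mu> * norm (d k))\<^sup>2 \<le> ?G\<^sup>2"
        using d_le[OF that] \<open>\<mu> > 0\<close> by (intro power_mono) auto
      also have "?G\<^sup>2 = ?G powr 2" by simp
      also have "\<dots> \<le> ?G powr (1 + \<zeta>)"
        using K[OF that] \<open>\<zeta> \<le> 1\<close> by (intro powr_mono') auto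
      finally have "(norm (d k))\<^sup>2 \<le> ?G powr (1 + \<zeta>) / \<mu>\<^sup>2"
        using \<open>\<mu> > 0\<close> by (simp add: field_simps power_mult_distrib)
      then show ?thesis using \<open>C > 0\<close> by (intro mult_left_mono) auto
    qed
    finally show ?thesis by (simp add: M_def algebra_simps)
  qed
  then show ?thesis using \<open>M > 0\<close> by blast
qed

end
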